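(* Let $\ell \ge 1$, $m \ge 2$ and $n = (3\ell+1)m$ (so $n \ge 6\ell+2$). Let $D$ be a minimum porous exponential dominating set of $C_{n,[\ell]}$. Then for every integer $s$ and every $0 \le i \le m-1$, the interval $[\,s+(3\ell+1)i,\ s+(3\ell+1)i+3\ell\,]$ contains exactly one vertex of $D$ (equivalently, for every such partition $\mathcal{I}$ of the vertex set into $m$ consecutive intervals of $3\ell+1$ vertices, $f^*(D,\mathcal{I}) = 1$ and $Z(D,\mathcal{I}) = 0$). Furthermore, $D$ is unique up to isomorphism, i.e. $D = \{c + (3\ell+1)t \bmod n : 0 \le t \le m-1\}$ for some vertex $c$.
   Context: $C_{n,[\ell]}$ has vertex set $\{0,\dots,n-1\}$ (mod $n$), with $v$ adjacent to $v\pm i \bmod n$ for $i\in\{1,\dots,\ell\}$. $\mathrm{dist}(u,v)$ is the shortest-path distance. $D\subseteq V$ is a porous exponential dominating set if $\sum_{d\in D}(1/2)^{\mathrm{dist}(d,v)-1}\ge 1$ for every vertex $v$; minimum means of minimum cardinality. For $i,j$, the interval $[i,j]$ is the set of consecutive integers mod $n$ going upward from $i$ to $j$. For a partition $\mathcal{I}=\bigcup_{k=0}^{m-1} I_k$ of the vertices into consecutive intervals, $f_k(D,\mathcal{I}) = |I_k\cap D|$, $f^*(D,\mathcal{I})=\max_k f_k(D,\mathcal{I})$, $z(D,\mathcal{I}) = \{k : f_k(D,\mathcal{I})=0\}$, $Z(D,\mathcal{I}) = |z(D,\mathcal{I})|$. *)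

theory Defs
  imports Complex_Main "HOL-Library.Disjoint_Sets"
begin

definition circ_verts :: "nat \<Rightarrow> int set" where
  "circ_verts n = {0..<int n}"

definition circ_edges :: "nat \<Rightarrow> nat \<Rightarrow> (int \<times> int) set" where
  "circ_edges n l = {(u, v). u \<in> circ_verts n \<and> v \<in> circ_verts n \<and>
     (\<exists>i\<in>{1..int l}. v = (u + i) mod int n \<or> v = (u - i) mod int n)}"

text \<open>The pairs in \<open>E ^^ k\<close> are those joined by a walk of length \<open>k\<close>, so the least such \<open>k\<close>
  is the shortest-path distance. It is meaningful only for vertices in the same component.\<close>

definition graph_dist :: "('a \<times> 'a) set \<Rightarrow> 'a \<Rightarrow> 'a \<Rightarrow> nat" where
  "graph_dist E u v = (LEAST k. (u, v) \<in> E ^^ k)"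

text \<open>The exponent is an integer: a vertex of \<open>D\<close> contributes weight \<open>2\<close> to itself.\<close>

definition porous_exp_dominating :: "'a set \<Rightarrow> ('a \<times> 'a) set \<Rightarrow> 'a set \<Rightarrow> bool" where
  "porous_exp_dominating V E D \<longleftrightarrow> D \<subseteq> V \<and>
     (\<forall>v\<in>V. (\<Sum>d\<in>D. (1 / 2 :: real) powi (int (graph_dist E d v) - 1)) \<ge> 1)"

definition min_porous_exp_dominating :: "'a set \<Rightarrow> ('a \<times> 'a) set \<Rightarrow> 'a set \<Rightarrow> bool" where
  "min_porous_exp_dominating V E D \<longleftrightarrow> porous_exp_dominating V E D \<and>
     (\<forall>D'. porous_exp_dominating V E D' \<longrightarrow> card D \<le> card D')"

definition graph_automorphism :: "'a set \<Rightarrow> ('a \<times> 'a) set \<Rightarrow> ('a \<Rightarrow> 'a) \<Rightarrow> bool" where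
  "graph_automorphism V E \<phi> \<longleftrightarrow> bij_betw \<phi> V V \<and>
     (\<forall>u\<in>V. \<forall>v\<in>V. (u, v) \<in> E \<longleftrightarrow> (\<phi> u, \<phi> v) \<in> E)"

text \<open>The endpoints \<open>i\<close> and \<open>j\<close> are arbitrary integers representing residues modulo \<open>n\<close>; going
  upward from \<open>i\<close>, the residue of \<open>j\<close> is first reached after \<open>(j - i) mod n\<close> steps.\<close>

definition circ_interval :: "nat \<Rightarrow> int \<Rightarrow> int \<Rightarrow> int set" where
  "circ_interval n i j = (\<lambda>k. k mod int n) ` {i..i + (j - i) mod int n}"

definition interval_partition :: "nat \<Rightarrow> nat \<Rightarrow> (nat \<Rightarrow> int set) \<Rightarrow> bool" where
  "interval_partition n m I \<longleftrightarrow>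
     (\<forall>k<m. \<exists>a b. I k = circ_interval n a b) \<and>
     disjoint_family_on I {..<m} \<and> (\<Union>k<m. I k) = circ_verts n"

definition f_count :: "'a set \<Rightarrow> (nat \<Rightarrow> 'a set) \<Rightarrow> nat \<Rightarrow> nat" where
  "f_count D I k = card (I k \<inter> D)"

definition f_star :: "nat \<Rightarrow> 'a set \<Rightarrow> (nat \<Rightarrow> 'a set) \<Rightarrow> nat" where
  "f_star m D I = Max (f_count D I ` {..<m})"

definition z_set :: "nat \<Rightarrow> 'a set \<Rightarrow> (nat \<Rightarrow> 'a set) \<Rightarrow> nat set" where
  "z_set m D I = {k. k < m \<and> f_count D I k = 0}"

definition Z_count :: "nat \<Rightarrow> 'a set \<Rightarrow> (nat \<Rightarrow> 'a set) \<Rightarrow> nat" where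
  "Z_count m D I = card (z_set m D I)"

end

theory Submission imports Defs begin

text \<open>Let \<open>K = 3l + 1\<close>. The residue class of \<open>0\<close> modulo \<open>K\<close> is dominating, so \<open>D\<close> has at most \<open>m\<close>
  points and its gaps average at least \<open>K\<close>; the claim is that all of them equal \<open>K\<close>.
  Read around the cycle in each of the two directions, every gap \<open>g \<le> K\<close> earns a credit \<open>K - g\<close>,
  and every gap \<open>g > K\<close> takes \<open>2(g - K) + 1\<close> from the credit accumulated so far, as far as available.
  If a gap \<open>g > K\<close> meets credits \<open>C\<close> and \<open>B\<close> from its two sides with \<open>C + B \<le> 2(g - K)\<close>, then
  the points of \<open>D\<close> near it are so sparse that some vertex inside the gap receives weight below \<open>1\<close>.
  Hence every long gap removes more than twice its excess from the two accounts, while a short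
  gap adds its deficit to both. The accounts return to their initial values
  after one turn, so long gaps would force the average gap below \<open>K\<close>.\<close>

section \<open>Weights received inside a gap\<close>

text \<open>The weight sent over displacement \<open>z\<close> if all steps go one way:
  \<open>z / l\<close>, rounded up, is the number of steps, and the factor \<open>2\<close> comes
  from the exponent distance minus one.\<close>

definition decay :: "nat \<Rightarrow> int \<Rightarrow> real" where
  "decay l z = 2 * (1 / 2) ^ nat \<lceil>real_of_int z / real l\<rceil>"

lemma decay_nonneg: "0 \<le> decay l z"
  by (simp add: decay_def)

lemma decay_antimono: "y \<le> z \<Longrightarrow> decay l z \<le> decay l y"
  unfolding decay_def
  by (intro mult_left_mono power_decreasing nat_mono ceiling_mono divide_right_mono) auto

text \<open>A displacement beyond \<open>q\<close> full steps needs at least \<open>q + 1\<close> of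
  them, and the extra halving cancels the factor \<open>2\<close>.\<close>

lemma decay_le:
  assumes "1 \<le> l" "int q * int l < z"
  shows "decay l z \<le> (1 / 2) ^ q"
proof -
  have "real q * real l < real_of_int z"
    using assms(2) by (metis of_int_less_iff of_int_mult of_int_of_nat_eq)
  then have "real_of_int (int q) < real_of_int z / real l"
    using assms(1) by (simp add: field_simps)
  then have "int q < \<lceil>real_of_int z / real l\<rceil>"
    by (simp only: less_ceiling_iff)
  then have "Suc q \<le> nat \<lceil>real_of_int z / real l\<rceil>" by linarith
  then have "(1 / 2 :: real) ^ nat \<lceil>real_of_int z / real l\<rceil> \<le> (1 / 2) ^ Suc q"
    by (intro power_decreasing) auto
  then show ?thesis by (simp add: decay_def)
qed

lemma le_decay:
  assumes "1 \<le> l" "z \<le> int q * int l"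
  shows "2 * (1 / 2) ^ q \<le> decay l z"
proof -
  have "real_of_int z \<le> real q * real l"
    using assms(2) by (metis of_int_le_iff of_int_mult of_int_of_nat_eq)
  then have "real_of_int z / real l \<le> real_of_int (int q)"
    using assms(1) by (simp add: field_simps)
  then have "\<lceil>real_of_int z / real l\<rceil> \<le> int q"
    by (simp only: ceiling_le_iff)
  then have "nat \<lceil>real_of_int z / real l\<rceil> \<le> q" by linarith
  then show ?thesis
    unfolding decay_def by (intro mult_left_mono power_decreasing) auto
qed

lemma decay_add_step:
  assumes "1 \<le> l" "0 \<le> z"
  shows "decay l (z + int l) = decay l z / 2"
proof -
  have "real_of_int (z + int l) / real l = real_of_int z / real l + 1"
    using assms(1) by (simp add: field_simps)
  then have "\<lceil>real_of_int (z + int l) / real l\<rceil> = \<lceil>real_of_int z / real l\<rceil> + 1"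
    by (simp only: ceiling_add_one)
  moreover have "0 \<le> \<lceil>real_of_int z / real l\<rceil>"
    using assms(2) by (simp add: order_less_le_trans[of "-1" 0])
  ultimately have "nat \<lceil>real_of_int (z + int l) / real l\<rceil> = Suc (nat \<lceil>real_of_int z / real l\<rceil>)"
    by linarith
  then show ?thesis by (simp add: decay_def)
qed

text \<open>Splitting off two terms leaves an eighth of a shorter sum, so the bound \<open>S\<close>
  should solve \<open>S = h 0 + h 1 + S / 8\<close>.\<close>

lemma sum_le_of_two_step_decay:
  fixes h :: "nat \<Rightarrow> real"
  assumes "\<And>k. h (k + 2) = h k / 8" "\<And>k. 0 \<le> h k"
  shows "(\<Sum>k<M. h k) \<le> 8 / 7 * (h 0 + h 1)"
proof (induction M rule: nat_induct2)
  case 0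
  then show ?case using assms(2)[of 0] assms(2)[of 1] by simp
next
  case 1
  then show ?case using assms(2)[of 0] assms(2)[of 1] by simp
next
  case (step M)
  have "(\<Sum>k<M + 2. h k) = h 0 + h 1 + (\<Sum>k<M. h (k + 2))"
    by (simp only: add_2_eq_Suc' sum.lessThan_Suc_shift) simp
  also have "(\<Sum>k<M. h (k + 2)) = (\<Sum>k<M. h k) / 8"
    by (simp only: assms(1) sum_divide_distrib)
  finally show ?case using step by simp
qed

text \<open>A sequence \<open>x\<close> is spread with credit \<open>C\<close> if \<open>x k\<close> can be the distance from a point of \<open>D\<close>
  to the \<open>k\<close>-th point of \<open>D\<close> behind it. The first alternative is the case that
  none of the \<open>k\<close> gaps in between exceeds \<open>3l + 1\<close>, the second one that some gap does.\<close>

definition spread :: "nat \<Rightarrow> nat \<Rightarrow> int \<Rightarrow> (nat \<Rightarrow> int) \<Rightarrow> bool" where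
  "spread l M C x \<longleftrightarrow> x 0 = 0 \<and> (\<forall>k<M. 0 \<le> x k) \<and>
     (\<forall>k<M. 1 \<le> k \<longrightarrow> int k * (3 * int l + 1) - C \<le> x k \<or>
                    (int k + 1) * (3 * int l + 1) - 1 - C \<le> 2 * x k)"

text \<open>Bounds the weight that one side of a gap sends to a vertex of the gap at distance
  \<open>y\<close> from the end on that side.\<close>

definition load :: "nat \<Rightarrow> nat \<Rightarrow> (nat \<Rightarrow> int) \<Rightarrow> int \<Rightarrow> real" where
  "load l M x y = (\<Sum>k<M. decay l (y + x k))"

text \<open>The first alternative of \<open>spread\<close> is the weaker one at
  \<open>k = 1\<close>; for \<open>k \<ge> 2\<close> the second is, as
  \<open>C \<le> 2 * int l\<close>. From there on the lower bounds on the distances grow by more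
  than \<open>3 * l / 2\<close> per point, so every second term drops by a factor \<open>8\<close>
  and the tail is geometric.\<close>

lemma load_le:
  assumes l: "1 \<le> l" and x: "spread l M C x" and C: "0 \<le> C" "C \<le> 2 * int l"
    and p: "int p * int l < y"
    and q: "int q * int l < y + (3 * int l + 1) - C"
    and s: "int s * int l \<le> 2 * y + 3 * int l - C"
  shows "load l M x y \<le> (1 / 2) ^ p + (1 / 2) ^ q
           + 8 / 7 * ((1 / 2) ^ ((6 + s) div 2) + (1 / 2) ^ ((9 + s) div 2))"
proof -
  define h :: "nat \<Rightarrow> real" where "h k = (1 / 2) ^ ((3 * (k + 2) + s) div 2)" for k
  define H where "H k = (if k = 0 then (1 / 2) ^ p else if k = 1 then (1 / 2) ^ q else h (k - 2))" for k
  have H_nonneg: "0 \<le> H k" for k by (simp add: H_def h_def)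
  have term_le: "decay l (y + x k) \<le> H k" if k: "k < M" for k
  proof -
    consider "k = 0" | "k = 1" | "2 \<le> k" by linarith
    then show ?thesis
    proof cases
      case 1
      have "x 0 = 0" using x by (simp add: spread_def)
      then show ?thesis using decay_le[OF l p] 1 by (simp add: H_def)
    next
      case 2
      have "3 * int l + 1 - C \<le> x 1 \<or> 2 * (3 * int l + 1) - 1 - C \<le> 2 * x 1"
        using x k 2 by (auto simp: spread_def)
      then have "3 * int l + 1 - C \<le> x 1" using C by auto
      then have "int q * int l < y + x 1" using q by linarith
      then show ?thesis using decay_le[OF l] 2 by (simp add: H_def)
    next
      case 3
      have "int k * (3 * int l + 1) - C \<le> x k \<or> (int k + 1) * (3 * int l + 1) - 1 - C \<le> 2 * x k"
        using x k 3 by (auto simp: spread_def)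
      moreover have "2 * (3 * int l + 1) \<le> int k * (3 * int l + 1)"
        using 3 by (intro mult_right_mono) auto
      ultimately have "(int k + 1) * (3 * int l + 1) - 1 - C \<le> 2 * x k"
        using C by (auto simp: algebra_simps)
      \<comment> \<open>\<open>(k + 1) * (3 * l + 1) - 1\<close> equals
        \<open>3 * (k + 1) * l + k\<close>; the surplus \<open>k\<close> gives the strictness that
        \<open>decay_le\<close> requires.\<close>
      then have big: "(3 * int k + int s) * int l < 2 * (y + x k)"
        using s 3 by (simp add: algebra_simps)
      have "2 * int ((3 * k + s) div 2) \<le> 3 * int k + int s" by linarith
      then have "2 * int ((3 * k + s) div 2) * int l \<le> (3 * int k + int s) * int l"
        by (intro mult_right_mono) auto
      then have "int ((3 * k + s) div 2) * int l < y + x k" using big by auto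
      then have "decay l (y + x k) \<le> (1 / 2) ^ ((3 * k + s) div 2)" by (rule decay_le[OF l])
      also have "\<dots> = H k"
      proof -
        have "3 * (k - 2 + 2) = 3 * k" using 3 by simp
        then show ?thesis using 3 by (simp only: H_def h_def) simp
      qed
      finally show ?thesis .
    qed
  qed
  have "load l M x y \<le> (\<Sum>k<M. H k)"
    unfolding load_def by (intro sum_mono term_le) simp
  \<comment> \<open>Two padding terms allow the indices \<open>0\<close> and \<open>1\<close> to be
    split off even when \<open>M < 2\<close>.\<close>
  also have "\<dots> \<le> (\<Sum>k<M + 2. H k)"
    by (intro sum_mono2) (auto simp: H_nonneg)
  also have "\<dots> = H 0 + H 1 + (\<Sum>k<M. H (k + 2))"
    by (simp only: add_2_eq_Suc' sum.lessThan_Suc_shift) simp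
  also have "(\<Sum>k<M. H (k + 2)) = (\<Sum>k<M. h k)" by (simp add: H_def)
  also have "(\<Sum>k<M. h k) \<le> 8 / 7 * (h 0 + h 1)"
  proof (rule sum_le_of_two_step_decay)
    fix k
    have "3 * (k + 2 + 2) + s = 3 * (k + 2) + s + 3 * 2" by simp
    then have "(3 * (k + 2 + 2) + s) div 2 = (3 * (k + 2) + s) div 2 + 3"
      by simp
    then show "h (k + 2) = h k / 8" unfolding h_def by (simp add: power_add power3_eq_cube)
  qed (simp add: h_def)
  finally show ?thesis by (simp add: H_def h_def)
qed

text \<open>Forgetting the point next to the gap lowers the credit by \<open>2l\<close>; moving the vertex \<open>l\<close> closer makes up for
  the lost weight. This reduces large credits to small ones.\<close>

lemma spread_drop:
  assumes l: "1 \<le> l" and x: "spread l M C x"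
  shows "\<exists>M' x'. spread l M' (C - 2 * int l) x' \<and>
           (\<forall>y\<ge>0. load l M x (y + int l) \<le> load l M' x' y)"
proof -
  have x0: "x 0 = 0" and pos: "\<And>k. k < M \<Longrightarrow> 0 \<le> x k" using x by (auto simp: spread_def)
  have half: "load l M x (y + int l) = (\<Sum>k<M. decay l (y + x k)) / 2" if y: "0 \<le> y" for y
    unfolding load_def sum_divide_distrib
  proof (rule sum.cong)
    fix k assume "k \<in> {..<M}"
    then have "decay l (y + x k + int l) = decay l (y + x k) / 2"
      using pos[of k] y by (intro decay_add_step[OF l]) auto
    then show "decay l (y + int l + x k) = decay l (y + x k) / 2" by (simp add: algebra_simps)
  qed simp
  show ?thesis
  proof (cases "M \<le> 1")
    case True
    have "spread l M (C - 2 * int l) x" using x True by (auto simp: spread_def)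
    moreover have "load l M x (y + int l) \<le> load l M x y" if "0 \<le> y" for y
      using half[OF that] sum_nonneg[of "{..<M}" "\<lambda>k. decay l (y + x k)"]
      by (simp add: load_def decay_nonneg)
    ultimately show ?thesis by blast
  next
    case False
    then obtain M'' where M: "M = Suc (Suc M'')"
      by (metis One_nat_def le_zero_eq nat_le_linear not0_implies_Suc not_less_eq_eq)
    \<comment> \<open>Indices \<open>0\<close> and \<open>1\<close> merge into index
      \<open>0\<close>: their halved weights sum to at most \<open>decay l y\<close>, as
      \<open>0 \<le> x 1\<close>. The later indices move down by one, which saves more than the
      \<open>2 * l\<close> of credit given up.\<close>
    define x' where "x' k = (if k = 0 then 0 else x (Suc k))" for k
    have "spread l (Suc M'') (C - 2 * int l) x'"
      unfolding spread_def
    proof (intro conjI allI impI)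
      fix k assume k: "k < Suc M''" "1 \<le> k"
      have "int (Suc k) * (3 * int l + 1) - C \<le> x (Suc k) \<or>
          (int (Suc k) + 1) * (3 * int l + 1) - 1 - C \<le> 2 * x (Suc k)"
        using x k unfolding spread_def M by auto
      then show "int k * (3 * int l + 1) - (C - 2 * int l) \<le> x' k \<or>
             (int k + 1) * (3 * int l + 1) - 1 - (C - 2 * int l) \<le> 2 * x' k"
        using k by (auto simp: x'_def algebra_simps)
    qed (use pos in \<open>auto simp: M x'_def\<close>)
    moreover have "load l M x (y + int l) \<le> load l (Suc M'') x' y" if y: "0 \<le> y" for y
    proof -
      let ?T = "\<Sum>k<M''. decay l (y + x (Suc (Suc k)))"
      have "load l M x (y + int l) = (decay l y + decay l (y + x 1) + ?T) / 2"
        unfolding half[OF y] by (simp add: M sum.lessThan_Suc_shift x0 del: sum.lessThan_Suc)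
      also have "\<dots> \<le> decay l y + ?T"
      proof -
        have "decay l (y + x 1) \<le> decay l y" using pos[of 1] M by (intro decay_antimono) auto
        moreover have "0 \<le> ?T" by (intro sum_nonneg decay_nonneg)
        ultimately show ?thesis by simp
      qed
      also have "\<dots> = load l (Suc M'') x' y"
        by (simp add: load_def x'_def sum.lessThan_Suc_shift del: sum.lessThan_Suc)
      finally show ?thesis .
    qed
    ultimately show ?thesis by blast
  qed
qed

text \<open>With both credits at most \<open>2l\<close>, either the two sides contribute less than \<open>11/16\<close> and \<open>5/16\<close>
  to a vertex about \<open>l\<close> from one end of the gap, or each contributes less than \<open>1/2\<close> to a vertex
  at distance more than \<open>2l\<close> from both ends.\<close>

lemma ex_underloaded_small_credit:
  assumes l: "1 \<le> l" and x: "spread l M C x" and z: "spread l M' B z"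
    and B: "0 \<le> B" "B \<le> C" "C \<le> 2 * int l" and e: "1 \<le> e" "C + B \<le> 2 * e"
  shows "\<exists>a b. 1 \<le> a \<and> 1 \<le> b \<and> a + b = 3 * int l + 1 + e \<and> load l M x a + load l M' z b < 1"
proof (cases "C + B \<le> 2 * int l + 2")
  case True
  \<comment> \<open>The term \<open>B\<close> in \<open>b\<close> puts the second point on that side
    beyond \<open>5 * l\<close>. Since \<open>e\<close> is at least \<open>1\<close> and at least
    \<open>B\<close>, still \<open>a > l\<close>.\<close>
  define b where "b = 2 * int l + max 1 B"
  define a where "a = 3 * int l + 1 + e - b"
  have a: "int 1 * int l < a" "int 3 * int l < a + (3 * int l + 1) - C"
    "int 4 * int l \<le> 2 * a + 3 * int l - C"
    using B e True l by (auto simp: a_def b_def max_def split: if_splits)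
  have b: "int 2 * int l < b" "int 5 * int l < b + (3 * int l + 1) - B"
    "int 7 * int l \<le> 2 * b + 3 * int l - B"
    using B by (auto simp: b_def max_def)
  have "load l M x a < 11 / 16"
    using load_le[OF l x _ B(3) a] B by (simp add: power_divide)
  moreover have "load l M' z b < 5 / 16"
    using load_le[OF l z _ _ b] B by (simp add: power_divide)
  ultimately show ?thesis
    using a(1) b(1) l by (intro exI[of _ a] exI[of _ b]) (auto simp: a_def)
next
  case False
  \<comment> \<open>Now \<open>e > l + 1\<close>, so the gap is long enough for a vertex more than
    \<open>2 * l\<close> away from both ends.\<close>
  define b where "b = 2 * int l + 1"
  define a where "a = 3 * int l + 1 + e - b"
  have a: "int 2 * int l < a" "int 3 * int l < a + (3 * int l + 1) - C"
    "int 5 * int l \<le> 2 * a + 3 * int l - C"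
    using B e False by (auto simp: a_def b_def)
  have b: "int 2 * int l < b" "int 3 * int l < b + (3 * int l + 1) - B"
    "int 5 * int l \<le> 2 * b + 3 * int l - B"
    using B by (auto simp: b_def)
  have "load l M x a < 1 / 2"
    using load_le[OF l x _ B(3) a] B by (simp add: power_divide)
  moreover have "load l M' z b < 1 / 2"
    using load_le[OF l z _ _ b] B by (simp add: power_divide)
  ultimately show ?thesis
    using a(1) b(1) l by (intro exI[of _ a] exI[of _ b]) (auto simp: a_def)
qed

text \<open>Induction on the excess \<open>e\<close>: by \<open>spread_drop\<close>, a credit above
  \<open>2 * l\<close> is lowered by \<open>2 * l\<close> while the gap shrinks by \<open>l\<close>,
  so both sides of \<open>C + B \<le> 2 * e\<close> fall equally. The new excess is positive because
  such a credit forces \<open>e > l\<close>.\<close>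

lemma ex_underloaded:
  assumes l: "1 \<le> l" and "spread l M C x" and "spread l M' B z"
    and "0 \<le> C" "0 \<le> B" and "1 \<le> e" "C + B \<le> 2 * e"
  shows "\<exists>a b. 1 \<le> a \<and> 1 \<le> b \<and> a + b = 3 * int l + 1 + e \<and> load l M x a + load l M' z b < 1"
  using assms(2-)
proof (induction "nat e" arbitrary: e M C x M' B z rule: less_induct)
  case less
  consider "2 * int l < C" | "2 * int l < B" | "B \<le> C" "C \<le> 2 * int l" | "C \<le> B" "B \<le> 2 * int l"
    by linarith
  then show ?case
  proof cases
    case 1
    obtain N u where u: "spread l N (C - 2 * int l) u"
      "\<And>y. 0 \<le> y \<Longrightarrow> load l M x (y + int l) \<le> load l N u y"
      using spread_drop[OF l less.prems(1)] by blast
    obtain a b where ab: "1 \<le> a" "1 \<le> b" "a + b = 3 * int l + 1 + (e - int l)"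
      "load l N u a + load l M' z b < 1"
      using less.hyps[of "e - int l" N "C - 2 * int l" u M' B z] u(1) less.prems l 1
      by auto
    then show ?thesis
      using u(2)[of a] by (intro exI[of _ "a + int l"] exI[of _ b]) auto
  next
    case 2
    obtain N u where u: "spread l N (B - 2 * int l) u"
      "\<And>y. 0 \<le> y \<Longrightarrow> load l M' z (y + int l) \<le> load l N u y"
      using spread_drop[OF l less.prems(2)] by blast
    obtain a b where ab: "1 \<le> a" "1 \<le> b" "a + b = 3 * int l + 1 + (e - int l)"
      "load l M x a + load l N u b < 1"
      using less.hyps[of "e - int l" M C x N "B - 2 * int l" u] u(1) less.prems l 2
      by auto
    then show ?thesis
      using u(2)[of b] by (intro exI[of _ a] exI[of _ "b + int l"]) auto
  next
    case 3
    then show ?thesis using ex_underloaded_small_credit[OF l less.prems(1,2)] less.prems by auto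
  next
    case 4
    then obtain b a where "1 \<le> b" "1 \<le> a" "b + a = 3 * int l + 1 + e"
        "load l M' z b + load l M x a < 1"
      using ex_underloaded_small_credit[OF l less.prems(2,1), of e] less.prems by auto
    then show ?thesis by (intro exI[of _ a] exI[of _ b]) auto
  qed
qed

section \<open>Credits around the cycle\<close>

text \<open>The extra \<open>- 1\<close> makes a long gap cost strictly more than twice its excess
  even if one account pays it alone.\<close>

definition balance :: "int \<Rightarrow> int \<Rightarrow> int" where
  "balance K g = (if g \<le> K then K - g else - 2 * (g - K) - 1)"

text \<open>Index \<open>0\<close> is the nearest gap and sums run outward. Their maximum is the
  balance of an account that is never overdrawn; the empty sum stands for an account emptied just
  before.\<close>

definition run_credit :: "nat \<Rightarrow> (nat \<Rightarrow> int) \<Rightarrow> int" where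
  "run_credit N c = Max ((\<lambda>k. \<Sum>t<k. c t) ` {..N})"

lemma sum_le_run_credit: "k \<le> N \<Longrightarrow> (\<Sum>t<k. c t) \<le> run_credit N c"
  unfolding run_credit_def by (intro Max_ge) auto

lemma run_credit_nonneg: "0 \<le> run_credit N c"
  using sum_le_run_credit[of 0 N c] by simp

text \<open>Only an inequality, since on the right the window of \<open>N\<close> gaps reaches one
  gap further.\<close>

lemma run_credit_step:
  "run_credit N c \<le> max 0 (c 0 + run_credit N (\<lambda>t. c (Suc t)))"
proof -
  have "(\<Sum>t<k. c t) \<le> max 0 (c 0 + run_credit N (\<lambda>t. c (Suc t)))" if "k \<le> N" for k
  proof (cases k)
    case (Suc j)
    have "(\<Sum>t<k. c t) = c 0 + (\<Sum>t<j. c (Suc t))"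
      unfolding Suc by (simp only: sum.lessThan_Suc_shift)
    then show ?thesis using sum_le_run_credit[of j N "\<lambda>t. c (Suc t)"] Suc that by simp
  qed simp
  then show ?thesis unfolding run_credit_def[of N c] by (subst Max_le_iff) auto
qed

text \<open>If the first \<open>k\<close> gaps are all short, their total deficit is at most the
  credit. Otherwise \<open>2 * g t + balance K (g t)\<close> is at least \<open>K\<close> for every
  gap and equals \<open>2 * K - 1\<close> for a long one; summing gives the second
  alternative.\<close>

lemma spread_of_gaps:
  fixes g :: "nat \<Rightarrow> int"
  assumes g: "\<And>t. 1 \<le> g t"
  shows "spread l N (run_credit N (\<lambda>t. balance (3 * int l + 1) (g t))) (\<lambda>k. \<Sum>t<k. g t)"
proof -
  define K where "K = 3 * int l + 1"
  define C where "C = run_credit N (\<lambda>t. balance K (g t))"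
  have K: "1 \<le> K" by (simp add: K_def)
  have "int k * K - C \<le> (\<Sum>t<k. g t) \<or> (int k + 1) * K - 1 - C \<le> 2 * (\<Sum>t<k. g t)"
    if k: "k < N" for k
  proof -
    have C: "(\<Sum>t<k. balance K (g t)) \<le> C"
      unfolding C_def using k by (intro sum_le_run_credit) simp
    show ?thesis
    proof (cases "\<forall>t<k. g t \<le> K")
      case True
      then have "(\<Sum>t<k. balance K (g t)) = (\<Sum>t<k. K - g t)"
        by (intro sum.cong) (auto simp: balance_def)
      then show ?thesis using C by (simp add: sum_subtractf)
    next
      case False
      then obtain s where s: "s < k" "K < g s" by auto
      have each: "K \<le> 2 * g t + balance K (g t)" for t
        using K g[of t] by (auto simp: balance_def)
      have "(2 * K - 1) + (int k - 1) * K = (2 * K - 1) + (\<Sum>t\<in>{..<k} - {s}. K)"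
        using s by (simp add: of_nat_diff)
      also have "\<dots> \<le> (2 * g s + balance K (g s)) + (\<Sum>t\<in>{..<k} - {s}. 2 * g t + balance K (g t))"
        using s by (intro add_mono sum_mono each) (auto simp: balance_def)
      also have "\<dots> = (\<Sum>t<k. 2 * g t + balance K (g t))"
        using s by (subst sum.remove[of _ s]) auto
      also have "\<dots> = 2 * (\<Sum>t<k. g t) + (\<Sum>t<k. balance K (g t))"
        by (simp add: sum.distrib sum_distrib_left)
      finally show ?thesis using C by (simp add: algebra_simps)
    qed
  qed
  moreover have "0 \<le> (\<Sum>t<k. g t)" for k
    using g by (intro sum_nonneg) (auto intro: order_trans[of 0 1])
  ultimately show ?thesis unfolding spread_def C_def K_def by auto
qed

lemma sum_telescope_periodic:
  fixes F :: "int \<Rightarrow> int"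
  assumes "F (int N) = F 0"
  shows "(\<Sum>i<N. F (int i + 1) - F (int i)) = 0"
  using sum_lessThan_telescope[of "\<lambda>i. F (int i)" N] assms by (simp add: add.commute)

text \<open>The difference of the two accounts is a periodic potential. Its changes sum to zero
  around the cycle, which forces equality in \<open>total\<close> and leaves no long gap.\<close>

lemma gaps_eq_of_excess_paid:
  fixes g :: "int \<Rightarrow> int"
  assumes per: "\<And>i. g (i + int N) = g i"
    and total: "int N * K \<le> (\<Sum>i<N. g (int i))"
    and paid: "\<And>i. K < g i \<Longrightarrow> 2 * (g i - K) <
       run_credit N (\<lambda>t. balance K (g (i - 1 - int t))) + run_credit N (\<lambda>t. balance K (g (i + 1 + int t)))"
  shows "\<forall>i<N. g (int i) = K"
proof -
  \<comment> \<open>\<open>F i\<close> leaves out gap \<open>i\<close> while \<open>B i\<close>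
    includes it, so gap \<open>i\<close> draws on \<open>F i\<close> and
    \<open>B (i + 1)\<close>.\<close>
  define F where "F i = run_credit N (\<lambda>t. balance K (g (i - 1 - int t)))" for i
  define B where "B i = run_credit N (\<lambda>t. balance K (g (i + int t)))" for i
  have Fp: "F (int N) = F 0"
  proof -
    have "g (int N - 1 - int t) = g (0 - 1 - int t)" for t
      using per[of "0 - 1 - int t"] by (simp add: algebra_simps)
    then show ?thesis by (simp add: F_def)
  qed
  have Bp: "B (int N) = B 0"
  proof -
    have "g (int N + int t) = g (0 + int t)" for t
      using per[of "int t"] by (simp add: algebra_simps)
    then show ?thesis by (simp add: B_def)
  qed
  have F_step: "F (i + 1) \<le> max 0 (balance K (g i) + F i)" for i
    using run_credit_step[of N "\<lambda>t. balance K (g (i + 1 - 1 - int t))"]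
    by (simp add: F_def algebra_simps)
  have B_step: "B i \<le> max 0 (balance K (g i) + B (i + 1))" for i
    using run_credit_step[of N "\<lambda>t. balance K (g (i + int t))"]
    by (simp add: B_def algebra_simps)
  have nonneg: "0 \<le> F i" "0 \<le> B i" for i
    by (simp_all add: F_def B_def run_credit_nonneg)
  \<comment> \<open>A long gap either takes its full price from one account or empties both; in the
    latter case \<open>paid\<close> says that they held more than twice the excess. A short gap adds
    at most its deficit to each account.\<close>
  have step: "(F (i + 1) - F i) - (B (i + 1) - B i) \<le> - 2 * (g i - K) - (if K < g i then 1 else 0)" for i
  proof (cases "K < g i")
    case True
    have "2 * (g i - K) < F i + B (i + 1)" using paid[OF True] by (simp add: F_def B_def)
    then show ?thesis
      using True F_step[of i] B_step[of i] nonneg[of i] nonneg[of "i + 1"]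
      by (auto simp: balance_def max_def split: if_splits)
  next
    case False
    then show ?thesis
      using F_step[of i] B_step[of i] nonneg[of i] nonneg[of "i + 1"]
      by (auto simp: balance_def max_def split: if_splits)
  qed
  define P :: int where "P = (\<Sum>i<N. if K < g (int i) then 1 else 0)"
  let ?s = "\<lambda>i. - 2 * (g (int i) - K) - (if K < g (int i) then 1 else 0)"
  have "0 = (\<Sum>i<N. (F (int i + 1) - F (int i)) - (B (int i + 1) - B (int i)))"
    by (simp only: sum_subtractf[of "\<lambda>i. F (int i + 1) - F (int i)"]
        sum_telescope_periodic[OF Fp] sum_telescope_periodic[OF Bp])
  also have "\<dots> \<le> (\<Sum>i<N. ?s i)" by (intro sum_mono step)
  also have "\<dots> = 2 * (int N * K - (\<Sum>i<N. g (int i))) - (\<Sum>i<N. if K < g (int i) then 1 else 0)"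
    by (simp add: sum_subtractf sum_negf flip: sum_distrib_left)
  finally have cost: "P \<le> 2 * (int N * K - (\<Sum>i<N. g (int i)))" by (simp add: P_def)
  have "0 \<le> P" unfolding P_def by (intro sum_nonneg) auto
  have P0: "P = 0" using cost total \<open>0 \<le> P\<close> by auto
  have eq: "(\<Sum>i<N. g (int i)) = int N * K" using cost total \<open>0 \<le> P\<close> by auto
  have le: "g (int i) \<le> K" if "i < N" for i
    using P0 that unfolding P_def by (subst (asm) sum_nonneg_eq_0_iff) (auto simp: not_less split: if_splits)
  have "(\<Sum>i<N. K - g (int i)) = 0" using eq by (simp add: sum_subtractf)
  then show ?thesis
    using le by (subst (asm) sum_nonneg_eq_0_iff) auto
qed

section \<open>Distances in the circulant graph\<close>

lemma walk_displacement:
  assumes "(u, v) \<in> circ_edges n l ^^ k"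
  shows "\<exists>j. \<bar>j\<bar> \<le> int k * int l \<and> v mod int n = (u + j) mod int n"
  using assms
proof (induction k arbitrary: v)
  case 0
  then show ?case by (intro exI[of _ 0]) auto
next
  case (Suc k)
  then obtain w where w: "(u, w) \<in> circ_edges n l ^^ k" "(w, v) \<in> circ_edges n l" by auto
  from Suc.IH[OF w(1)] obtain j where j: "\<bar>j\<bar> \<le> int k * int l" "w mod int n = (u + j) mod int n"
    by blast
  from w(2) obtain i where i: "i \<in> {1..int l}" "v = (w + i) mod int n \<or> v = (w - i) mod int n"
    by (auto simp: circ_edges_def)
  then obtain i' where i': "\<bar>i'\<bar> \<le> int l" "v = (w + i') mod int n"
    by (metis abs_minus_cancel abs_of_nonneg atLeastAtMost_iff diff_conv_add_uminus order_trans zero_le_one)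
  have "v mod int n = (w mod int n + i') mod int n" using i'(2) by (simp add: mod_simps)
  also have "\<dots> = (u + (j + i')) mod int n" unfolding j(2) by (simp add: mod_simps add.assoc)
  finally show ?case using j(1) i'(1)
    by (intro exI[of _ "j + i'"]) (auto simp: algebra_simps)
qed

lemma ex_walk_directed:
  assumes n: "0 < n" and u: "u \<in> circ_verts n" and j: "0 \<le> j" "j \<le> int q * int l"
    and s: "s = 1 \<or> s = - 1"
  shows "\<exists>k\<le>q. (u, (u + s * j) mod int n) \<in> circ_edges n l ^^ k"
  using j
proof (induction q arbitrary: j)
  case 0
  then show ?case using u by (auto simp: circ_verts_def)
next
  case (Suc q)
  show ?case
  proof (cases "j \<le> int q * int l")
    case True
    then show ?thesis using Suc by (meson le_Suc_eq)
  next
    case False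
    \<comment> \<open>As \<open>j\<close> exceeds \<open>int q * int l\<close>, it is positive, so
      this is a legal edge length; the rest fits into \<open>q\<close> steps.\<close>
    define i where "i = min j (int l)"
    have i: "0 \<le> j - i" "j - i \<le> int q * int l" "i \<in> {1..int l}"
      using False Suc.prems by (auto simp: i_def min_def algebra_simps)
         (use False in \<open>metis Suc.prems(1) False int_one_le_iff_zero_less linorder_not_le mult_nonneg_nonneg of_nat_0_le_iff order_le_less_trans\<close>)+
    obtain k where k: "k \<le> q" "(u, (u + s * (j - i)) mod int n) \<in> circ_edges n l ^^ k"
      using Suc.IH[OF i(1,2)] by blast
    have "((u + s * (j - i)) mod int n, (u + s * j) mod int n) \<in> circ_edges n l"
      unfolding circ_edges_def using n s i(3)
      by (auto simp: circ_verts_def mod_simps algebra_simps intro!: bexI[of _ i])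
    with k show ?thesis by (intro exI[of _ "Suc k"]) auto
  qed
qed

lemma graph_dist_circ_le:
  assumes "0 < n" "u \<in> circ_verts n" "\<bar>j\<bar> \<le> int q * int l"
  shows "graph_dist (circ_edges n l) u ((u + j) mod int n) \<le> q"
proof -
  have "\<exists>k\<le>q. (u, (u + j) mod int n) \<in> circ_edges n l ^^ k"
    using ex_walk_directed[OF assms(1,2) _ assms(3), of 1] ex_walk_directed[OF assms(1,2) _ assms(3), of "- 1"]
    by (cases "0 \<le> j") auto
  then show ?thesis unfolding graph_dist_def by (meson Least_le order_trans)
qed

text \<open>A shortest walk has a signed displacement; its sign decides which of the two terms
  already bounds the weight. Using the sum lets the two sides of a gap be treated
  separately.\<close>

lemma dist_weight_le_decay:
  assumes l: "1 \<le> l" and n: "0 < n" and u: "u \<in> circ_verts n" and v: "v \<in> circ_verts n"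
  shows "(1 / 2 :: real) powi (int (graph_dist (circ_edges n l) u v) - 1)
           \<le> decay l ((v - u) mod int n) + decay l ((u - v) mod int n)"
proof -
  define k where "k = graph_dist (circ_edges n l) u v"
  \<comment> \<open>Some walk must exist before the \<open>LEAST\<close> in
    \<open>graph_dist\<close> is known to be attained.\<close>
  have "0 \<le> (v - u) mod int n" using n by simp
  moreover from this have "(v - u) mod int n \<le> int (nat ((v - u) mod int n)) * int l"
    using l mult_left_mono[of 1 "int l" "(v - u) mod int n"] by simp
  ultimately have "\<exists>k\<le>nat ((v - u) mod int n). (u, (u + 1 * ((v - u) mod int n)) mod int n) \<in> circ_edges n l ^^ k"
    by (intro ex_walk_directed[OF n u]) auto
  then have "\<exists>q. (u, v) \<in> circ_edges n l ^^ q"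
    using v by (auto simp: mod_simps circ_verts_def)
  then have "(u, v) \<in> circ_edges n l ^^ k" unfolding k_def graph_dist_def by (rule LeastI_ex)
  then obtain j where j: "\<bar>j\<bar> \<le> int k * int l" "v mod int n = (u + j) mod int n"
    using walk_displacement by blast
  have vu: "(v - u) mod int n = j mod int n"
    using j(2) by (metis add_diff_cancel_left' mod_diff_left_eq)
  have uv: "(u - v) mod int n = (- j) mod int n"
    using vu by (metis minus_diff_eq mod_minus_eq)
  have "2 * (1 / 2) ^ k \<le> decay l ((v - u) mod int n) + decay l ((u - v) mod int n)"
  proof (cases "0 \<le> j")
    case True
    then have "(v - u) mod int n \<le> int k * int l" using vu j(1) n
      by (metis abs_of_nonneg order_trans zmod_le_nonneg_dividend)
    then show ?thesis using le_decay[OF l] decay_nonneg by (smt (verit))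
  next
    case False
    then have "(u - v) mod int n \<le> - j" using uv
      by (metis le_cases neg_0_le_iff_le zmod_le_nonneg_dividend)
    then have "(u - v) mod int n \<le> int k * int l" using False j(1) by linarith
    then show ?thesis using le_decay[OF l] decay_nonneg by (smt (verit))
  qed
  moreover have "(1 / 2 :: real) powi (int k - 1) = 2 * (1 / 2) ^ k"
    by (simp add: power_int_diff)
  ultimately show ?thesis by (simp add: k_def)
qed

section \<open>Residue classes as dominating sets\<close>

definition progression :: "nat \<Rightarrow> nat \<Rightarrow> int \<Rightarrow> int set" where
  "progression n K c = {v \<in> circ_verts n. v mod int K = c mod int K}"

lemma progression_eq:
  assumes K: "0 < K" and m: "0 < m" and n: "n = K * m"
  shows "progression n K c = {(c + int (K * t)) mod int n | t. t < m}"
proof (intro equalityI subsetI)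
  fix v assume "v \<in> progression n K c"
  then have v: "0 \<le> v" "v < int n" "(v - c) mod int K = 0"
    by (auto simp: progression_def circ_verts_def mod_eq_dvd_iff)
  define t where "t = nat (((v - c) mod int n) div int K)"
  have n0: "0 < int n" using K m n by simp
  have "(v - c) mod int n mod int K = 0" using v(3) n by (simp add: mod_mod_cancel)
  then have "int K * (((v - c) mod int n) div int K) = (v - c) mod int n"
    by (simp add: mult_div_mod_eq [symmetric] minus_mod_eq_mult_div [symmetric])
  moreover have "0 \<le> ((v - c) mod int n) div int K"
    using n0 K by (simp add: pos_imp_zdiv_nonneg_iff)
  ultimately have t: "int (K * t) = (v - c) mod int n" by (simp add: t_def)
  then have "int K * int t < int K * int m" using n0 n by (metis of_nat_mult pos_mod_bound)
  then have "t < m" using K by simp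
  moreover have "(c + int (K * t)) mod int n = v" unfolding t using v by (simp add: mod_simps)
  ultimately show "v \<in> {(c + int (K * t)) mod int n | t. t < m}" by blast
next
  fix v assume "v \<in> {(c + int (K * t)) mod int n | t. t < m}"
  then obtain t where t: "v = (c + int (K * t)) mod int n" by blast
  have "v mod int K = (c + int K * int t) mod int K" unfolding t n by (simp add: mod_mod_cancel)
  then show "v \<in> progression n K c"
    using K m n by (simp add: progression_def circ_verts_def t)
qed

lemma card_progression_0_le:
  assumes "0 < K" "0 < m" "n = K * m"
  shows "finite (progression n K 0)" "card (progression n K 0) \<le> m"
proof -
  have "progression n K 0 = (\<lambda>t. (0 + int (K * t)) mod int n) ` {..<m}"
    unfolding progression_eq[OF assms] by auto
  then show "finite (progression n K 0)" "card (progression n K 0) \<le> m"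
    by (simp_all add: order_trans[OF card_image_le])
qed

text \<open>A vertex lies between consecutive class members \<open>d\<close> and \<open>d'\<close>.
  Either one of them is within \<open>l\<close> and gives weight \<open>1\<close>, or both are
  within \<open>2 * l\<close> and give \<open>1 / 2\<close> each.\<close>

lemma porous_exp_dominating_progression:
  assumes l: "1 \<le> l" and m: "2 \<le> m" and n: "n = (3 * l + 1) * m"
  shows "porous_exp_dominating (circ_verts n) (circ_edges n l) (progression n (3 * l + 1) 0)"
  unfolding porous_exp_dominating_def
proof (intro conjI ballI)
  define K where "K = 3 * l + 1"
  have K: "0 < K" "n = K * m" using n by (auto simp: K_def)
  have n0: "0 < n" using K m by simp
  define D where "D = progression n K 0"
  show "progression n (3 * l + 1) 0 \<subseteq> circ_verts n" by (auto simp: progression_def)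
  fix v assume v: "v \<in> circ_verts n"
  define W where "W d = (1 / 2 :: real) powi (int (graph_dist (circ_edges n l) d v) - 1)" for d
  have W_nonneg: "0 \<le> W d" for d by (simp add: W_def)
  have fin: "finite D" using card_progression_0_le(1)[of K m n] K m by (simp add: D_def)
  have W_ge: "2 * (1 / 2) ^ q \<le> W d"
    if "d \<in> circ_verts n" "v = (d + j) mod int n" "\<bar>j\<bar> \<le> int q * int l" for d j q
  proof -
    have "graph_dist (circ_edges n l) d v \<le> q"
      using graph_dist_circ_le[OF n0 that(1,3)] that(2) by simp
    then have "(1 / 2 :: real) ^ q \<le> (1 / 2) ^ graph_dist (circ_edges n l) d v"
      by (intro power_decreasing) auto
    then show ?thesis by (simp add: W_def power_int_diff)
  qed
  define r where "r = v mod int K"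
  define d where "d = v - r"
  define d' where "d' = (d + int K) mod int n"
  have r: "0 \<le> r" "r \<le> 3 * int l" 
    using pos_mod_sign[of "int K" v] pos_mod_bound[of "int K" v] K(1)
    unfolding r_def by (auto simp: K_def simp del: pos_mod_bound)
  have d_mod: "d mod int K = 0" unfolding d_def r_def by (simp add: minus_mod_eq_mult_div)
  have d_nonneg: "0 \<le> d" using v unfolding d_def r_def
    by (auto simp: circ_verts_def minus_mod_eq_mult_div K pos_imp_zdiv_nonneg_iff)
  have dV: "d \<in> circ_verts n" using v r(1) d_nonneg by (auto simp: circ_verts_def d_def)
  have d'V: "d' \<in> circ_verts n" using n0 by (simp add: circ_verts_def d'_def)
  have dD: "d \<in> D" using dV d_mod by (simp add: D_def progression_def)
  have "d' mod int K = 0" using d_mod unfolding d'_def K(2) by (simp add: mod_mod_cancel)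
  then have d'D: "d' \<in> D" using d'V by (simp add: D_def progression_def)
  have vd: "v = (d + r) mod int n" using v by (simp add: d_def circ_verts_def)
  have vd': "v = (d' + (r - int K)) mod int n" using vd by (simp add: d'_def mod_simps)
  have "2 * K \<le> n" using K(2) m by simp
  \<comment> \<open>The two halves may be added only for distinct points; this is where
    \<open>m \<ge> 2\<close> enters.\<close>
  have neq: "d \<noteq> d'"
  proof
    assume "d = d'"
    then have "(d + 0) mod int n = (d + int K) mod int n"
      using dV by (simp add: d'_def circ_verts_def)
    then have "int n dvd int K" by (simp add: mod_eq_dvd_iff)
    then show False using \<open>2 * K \<le> n\<close> K(1) by (auto dest!: zdvd_imp_le)
  qed
  have "1 \<le> sum W D"
  proof -
    consider "r \<le> int l" | "2 * int l < r" | "int l < r" "r \<le> 2 * int l" by linarith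
    then show ?thesis
    proof cases
      case 1
      then have "1 \<le> W d" using W_ge[OF dV vd, of 1] r by simp
      then show ?thesis using member_le_sum[OF dD _ fin, of W] W_nonneg by fastforce
    next
      case 2
      then have "1 \<le> W d'" using W_ge[OF d'V vd', of 1] r by (simp add: K_def)
      then show ?thesis using member_le_sum[OF d'D _ fin, of W] W_nonneg by fastforce
    next
      case 3
      then have "1 / 2 \<le> W d" "1 / 2 \<le> W d'"
        using W_ge[OF dV vd, of 2] W_ge[OF d'V vd', of 2] r by (simp_all add: K_def power2_eq_square)
      then have "1 \<le> sum W {d, d'}" using neq by simp
      also have "\<dots> \<le> sum W D" using dD d'D fin W_nonneg by (intro sum_mono2) auto
      finally show ?thesis .
    qed
  qed
  then show "1 \<le> (\<Sum>d\<in>progression n (3 * l + 1) 0.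
      (1 / 2 :: real) powi (int (graph_dist (circ_edges n l) d v) - 1))"
    by (simp add: W_def D_def K_def)
qed

section \<open>Intervals and rotations of residue classes\<close>

lemma inj_on_mod_window: "inj_on (\<lambda>k. k mod int n) {i..<i + int n}"
proof (rule inj_onI)
  fix a b assume a: "a \<in> {i..<i + int n}" and b: "b \<in> {i..<i + int n}"
    and eq: "a mod int n = b mod int n"
  have "(a - i) mod int n = (b - i) mod int n" using eq by (metis mod_diff_left_eq)
  then show "a = b" using a b by simp
qed

lemma card_circ_interval:
  assumes "0 < n"
  shows "card (circ_interval n i j) = nat ((j - i) mod int n) + 1"
proof -
  have "{i..i + (j - i) mod int n} \<subseteq> {i..<i + int n}"
    using assms pos_mod_bound[of "int n" "j - i"] by (auto simp del: pos_mod_bound)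
  then have "inj_on (\<lambda>k. k mod int n) {i..i + (j - i) mod int n}"
    using inj_on_mod_window inj_on_subset by blast
  then show ?thesis using assms by (simp add: circ_interval_def card_image nat_add_distrib)
qed

text \<open>The interval consists of \<open>K\<close> consecutive integers, which meet each residue
  class modulo \<open>K\<close> once; reduction modulo \<open>n\<close> preserves these classes as
  \<open>K\<close> divides \<open>n\<close>.\<close>

lemma card_circ_interval_inter_progression:
  assumes K: "0 < K" and n: "n = K * m" and m: "0 < m" and ij: "(j - i) mod int n = int K - 1"
  shows "card (circ_interval n i j \<inter> progression n K c) = 1"
proof -
  have n0: "0 < n" using assms by simp
  define r where "r = (c - i) mod int K"
  have r: "0 \<le> r" "r < int K" using K by (auto simp: r_def)
  have "circ_interval n i j \<inter> progression n K c = {(i + r) mod int n}"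
  proof (intro equalityI subsetI)
    fix v assume "v \<in> circ_interval n i j \<inter> progression n K c"
    then obtain k where k: "k \<in> {i..i + (int K - 1)}" "v = k mod int n" "v mod int K = c mod int K"
      by (auto simp: circ_interval_def progression_def ij)
    have "k mod int K = c mod int K" using k n by (simp add: mod_mod_cancel)
    then have "(k - i) mod int K = r" unfolding r_def by (metis mod_diff_left_eq)
    then have "k - i = r" using k(1) by simp
    then show "v \<in> {(i + r) mod int n}" using k(2) by auto
  next
    fix v assume "v \<in> {(i + r) mod int n}"
    then have v: "v = (i + r) mod int n" by simp
    have "v mod int K = (i + r) mod int K" unfolding v n by (simp add: mod_mod_cancel)
    also have "\<dots> = c mod int K" unfolding r_def by (simp add: mod_simps)
    finally show "v \<in> circ_interval n i j \<inter> progression n K c"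
      using n0 r by (auto simp: v circ_interval_def progression_def circ_verts_def ij)
  qed
  then show ?thesis by simp
qed

lemma rotation_progression:
  assumes K: "0 < K" and n: "n = K * m" and m: "0 < m"
  shows "\<exists>\<phi>. graph_automorphism (circ_verts n) (circ_edges n l) \<phi> \<and> \<phi> ` progression n K c = progression n K c'"
proof -
  have n0: "0 < n" using assms by simp
  define \<phi> where "\<phi> v = (v + (c' - c)) mod int n" for v
  define \<psi> where "\<psi> v = (v - (c' - c)) mod int n" for v
  have \<phi>V: "\<phi> v \<in> circ_verts n" and \<psi>V: "\<psi> v \<in> circ_verts n" for v
    using n0 by (auto simp: \<phi>_def \<psi>_def circ_verts_def)
  have \<psi>\<phi>: "\<psi> (\<phi> v) = v" and \<phi>\<psi>: "\<phi> (\<psi> v) = v" if "v \<in> circ_verts n" for v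
    using that by (auto simp: \<phi>_def \<psi>_def circ_verts_def mod_simps)
  have bij: "bij_betw \<phi> (circ_verts n) (circ_verts n)"
    by (rule bij_betw_byWitness[of _ \<psi>]) (auto simp: \<psi>\<phi> \<phi>\<psi> \<phi>V \<psi>V)
  have edge: "(u, v) \<in> circ_edges n l \<longleftrightarrow> (\<phi> u, \<phi> v) \<in> circ_edges n l"
    if "u \<in> circ_verts n" "v \<in> circ_verts n" for u v
  proof -
    have "v = (u + i) mod int n \<longleftrightarrow> \<phi> v = (\<phi> u + i) mod int n" for i
    proof -
      have "v = (u + i) mod int n \<longleftrightarrow> \<phi> v = \<phi> ((u + i) mod int n)"
        using that n0 \<psi>\<phi> by (metis atLeastLessThan_iff circ_verts_def of_nat_0_less_iff pos_mod_bound pos_mod_sign)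
      also have "\<phi> ((u + i) mod int n) = (\<phi> u + i) mod int n"
        unfolding \<phi>_def by (simp only: mod_add_left_eq) (simp only: ac_simps)
      finally show ?thesis .
    qed
    from this this[of "- i" for i] show ?thesis
      using that \<phi>V by (simp add: circ_edges_def)
  qed
  have "\<phi> ` progression n K c = progression n K c'"
  proof (intro equalityI subsetI)
    fix v assume "v \<in> \<phi> ` progression n K c"
    then obtain u where u: "v = \<phi> u" "u mod int K = c mod int K" by (auto simp: progression_def)
    have "v mod int K = (u + (c' - c)) mod int K" unfolding u(1) \<phi>_def n by (simp add: mod_mod_cancel)
    also have "\<dots> = (c + (c' - c)) mod int K" using u(2) by (metis mod_add_left_eq)
    finally show "v \<in> progression n K c'" using \<phi>V u(1) by (simp add: progression_def)
  next
    fix v assume v: "v \<in> progression n K c'"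
    have "\<psi> v mod int K = (v - (c' - c)) mod int K" unfolding \<psi>_def n by (simp add: mod_mod_cancel)
    also have "\<dots> = (c' - (c' - c)) mod int K"
      using v unfolding progression_def by (intro mod_diff_cong) auto
    finally have "\<psi> v \<in> progression n K c" using \<psi>V by (simp add: progression_def)
    moreover have "\<phi> (\<psi> v) = v" using v by (simp add: progression_def \<phi>\<psi>)
    ultimately show "v \<in> \<phi> ` progression n K c" by force
  qed
  then show ?thesis using bij edge unfolding graph_automorphism_def by blast
qed

section \<open>Long gaps are impossible\<close>

text \<open>Enumerates in increasing order, from the least element of \<open>D\<close> at index \<open>0\<close>, all integers congruent modulo \<open>n\<close>
  to an element of \<open>D\<close>.\<close>

definition lift_enum :: "nat \<Rightarrow> int set \<Rightarrow> int \<Rightarrow> int" where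
  "lift_enum n D i = sorted_list_of_set D ! nat (i mod int (card D)) + int n * (i div int (card D))"

context
  fixes n :: nat and D :: "int set"
  assumes DV: "D \<subseteq> circ_verts n" and D_ne: "D \<noteq> {}"
begin

lemma finite_vertex_subset: "finite D"
  using DV finite_subset by (auto simp: circ_verts_def)

lemma card_vertex_subset_pos: "0 < card D"
  using finite_vertex_subset D_ne by (simp add: card_gt_0_iff)

lemma nth_sorted_list_mem: "k < card D \<Longrightarrow> sorted_list_of_set D ! k \<in> D"
  using finite_vertex_subset by (metis length_sorted_list_of_set nth_mem set_sorted_list_of_set)

lemma lift_enum_add_period: "lift_enum n D (i + int (card D)) = lift_enum n D i + int n"
  using card_vertex_subset_pos by (simp add: lift_enum_def algebra_simps)

lemma lift_enum_mod: "lift_enum n D i mod int n = sorted_list_of_set D ! nat (i mod int (card D))"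
proof -
  have "nat (i mod int (card D)) < card D" using card_vertex_subset_pos by (simp add: nat_less_iff)
  from nth_sorted_list_mem[OF this] DV show ?thesis by (auto simp: lift_enum_def circ_verts_def)
qed

lemma lift_enum_less_Suc: "lift_enum n D i < lift_enum n D (i + 1)"
proof -
  let ?N = "int (card D)" and ?L = "sorted_list_of_set D"
  have N: "0 < ?N" using card_vertex_subset_pos by simp
  show ?thesis
  proof (cases "i mod ?N + 1 < ?N")
    case True
    have "(i + 1) mod ?N = i mod ?N + 1"
      using True N by (metis add_nonneg_nonneg mod_add_left_eq mod_pos_pos_trivial pos_mod_sign zero_le_one)
    moreover have "(i + 1) div ?N = i div ?N"
      using calculation N by (smt (verit, best) div_mult_mod_eq mult_cancel_right)
    moreover have "?L ! nat (i mod ?N) < ?L ! nat (i mod ?N + 1)"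
      using True N sorted_wrt_nth_less[OF strict_sorted_list_of_set[of D], of "nat (i mod ?N)" "nat (i mod ?N + 1)"]
      by (simp add: nat_less_iff)
    ultimately show ?thesis by (simp add: lift_enum_def)
  next
    case False
    \<comment> \<open>Wrap-around: the next value is the least element raised by \<open>n\<close>,
      which exceeds every element of \<open>D\<close>.\<close>
    have last: "i mod ?N = ?N - 1" using False pos_mod_bound[OF N, of i] by linarith
    have ieq: "i + 1 = (i div ?N + 1) * ?N" using div_mult_mod_eq[of i ?N] last by (simp add: algebra_simps)
    have "(i + 1) mod ?N = 0" "(i + 1) div ?N = i div ?N + 1"
      unfolding ieq using N by simp_all
    moreover have "?L ! nat (i mod ?N) < int n" "0 \<le> ?L ! 0"
      using nth_sorted_list_mem[of "nat (i mod ?N)"] nth_sorted_list_mem[of 0] card_vertex_subset_pos DV last N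
      by (auto simp: circ_verts_def nat_less_iff)
    ultimately show ?thesis by (simp add: lift_enum_def algebra_simps)
  qed
qed

lemma bij_betw_lift_enum_up: "bij_betw (\<lambda>k. lift_enum n D (i + int k) mod int n) {..<card D} D"
proof -
  let ?N = "int (card D)"
  have N: "0 < ?N" using card_vertex_subset_pos by simp
  have nat_mod: "nat (j mod ?N) < card D" for j using N by (simp add: nat_less_iff)
  have "inj_on (\<lambda>k. lift_enum n D (i + int k) mod int n) {..<card D}"
  proof (rule inj_onI)
    fix a b assume a: "a \<in> {..<card D}" and b: "b \<in> {..<card D}"
      and eq: "lift_enum n D (i + int a) mod int n = lift_enum n D (i + int b) mod int n"
    have "nat ((i + int a) mod ?N) = nat ((i + int b) mod ?N)"
      using eq nat_mod finite_vertex_subset unfolding lift_enum_mod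
      by (subst (asm) nth_eq_iff_index_eq) auto
    then have "(i + int a) mod ?N = (i + int b) mod ?N" using N by (simp add: eq_nat_nat_iff)
    then have "(i + int a - i) mod ?N = (i + int b - i) mod ?N" by (metis mod_diff_left_eq)
    then show "a = b" using a b by simp
  qed
  moreover have "(\<lambda>k. lift_enum n D (i + int k) mod int n) ` {..<card D} \<subseteq> D"
    using nth_sorted_list_mem nat_mod by (auto simp: lift_enum_mod)
  ultimately show ?thesis
    using finite_vertex_subset by (simp add: bij_betw_def card_subset_eq card_image)
qed

lemma bij_betw_lift_enum_down: "bij_betw (\<lambda>k. lift_enum n D (i - int k) mod int n) {..<card D} D"
proof -
  have "bij_betw (\<lambda>k. card D - 1 - k) {..<card D} {..<card D}"
    by (rule bij_betw_byWitness[of _ "\<lambda>k. card D - 1 - k"]) auto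
  from bij_betw_trans[OF this bij_betw_lift_enum_up[of "i - int (card D - 1)"]]
  have "bij_betw (\<lambda>k. lift_enum n D (i - int (card D - 1) + int (card D - 1 - k)) mod int n) {..<card D} D"
    by (simp add: comp_def)
  then show ?thesis
    by (rule bij_betw_cong[THEN iffD1, rotated]) (simp add: of_nat_diff)
qed

end


text \<open>An unpaid long gap would contain an underloaded vertex, so
  \<open>gaps_eq_of_excess_paid\<close> makes all gaps equal to \<open>K\<close>.\<close>

lemma progression_of_dominating:
  assumes l: "1 \<le> l" and m: "0 < m" and n: "n = (3 * l + 1) * m"
    and dom: "porous_exp_dominating (circ_verts n) (circ_edges n l) D" and card: "card D \<le> m"
  shows "\<exists>c\<in>circ_verts n. D = progression n (3 * l + 1) c"
proof -
  define K where "K = 3 * l + 1"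
  define N where "N = card D"
  have n0: "0 < n" and nK: "n = K * m" and K: "0 < K" using n m by (auto simp: K_def)
  have DV: "D \<subseteq> circ_verts n"
    and W_ge: "\<And>v. v \<in> circ_verts n \<Longrightarrow>
      1 \<le> (\<Sum>d\<in>D. (1 / 2 :: real) powi (int (graph_dist (circ_edges n l) d v) - 1))"
    using dom by (auto simp: porous_exp_dominating_def)
  have ne: "D \<noteq> {}" using W_ge[of 0] n0 by (auto simp: circ_verts_def)
  note DE = DV ne
  have N: "0 < N" using card_vertex_subset_pos[OF DE] by (simp add: N_def)
  define p where "p = lift_enum n D"
  define g where "g i = p (i + 1) - p i" for i
  have g1: "1 \<le> g i" for i using lift_enum_less_Suc[OF DE, of i] by (simp add: g_def p_def)
  have p_period: "p (i + int N) = p i + int n" for i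
    using lift_enum_add_period[OF DE] by (simp add: p_def N_def)
  have g_period: "g (i + int N) = g i" for i
    using p_period[of i] p_period[of "i + 1"] by (simp add: g_def algebra_simps)
  have down: "(\<Sum>t<k. g (i - 1 - int t)) = p i - p (i - int k)" for i k
    by (induction k) (auto simp: g_def algebra_simps)
  have up: "(\<Sum>t<k. g (i + int t)) = p (i + int k) - p i" for i k
    by (induction k) (auto simp: g_def algebra_simps)
  have g_nonneg: "0 \<le> g i" for i using g1[of i] by simp
  have mono: "p (i - int (N - 1)) \<le> p (i - int k)" "p (i + int k) \<le> p (i + int (N - 1))" if "k < N" for i k
  proof -
    have "(\<Sum>t<k. g (i - 1 - int t)) \<le> (\<Sum>t<N - 1. g (i - 1 - int t))"
      "(\<Sum>t<k. g (i + int t)) \<le> (\<Sum>t<N - 1. g (i + int t))"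
      using that g_nonneg by (auto intro!: sum_mono2)
    then show "p (i - int (N - 1)) \<le> p (i - int k)" "p (i + int k) \<le> p (i + int (N - 1))"
      unfolding down up by simp_all
  qed
  have total: "(\<Sum>i<N. g (int i)) = int n"
    using up[of 0 N] p_period[of 0] by simp
  have "\<forall>i<N. g (int i) = int K"
  proof (rule gaps_eq_of_excess_paid)
    show "int N * int K \<le> (\<Sum>i<N. g (int i))"
      using card mult_le_mono1[of N m K] unfolding total nK by (simp add: N_def mult.commute flip: of_nat_mult)
  next
    fix i assume excess: "int K < g i"
    let ?C = "run_credit N (\<lambda>t. balance (int K) (g (i - 1 - int t)))"
    let ?B = "run_credit N (\<lambda>t. balance (int K) (g (i + 1 + int t)))"
    show "2 * (g i - int K) < ?C + ?B"
    proof (rule ccontr)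
      assume unpaid: "\<not> ?thesis"
      define x where "x k = (\<Sum>t<k. g (i - 1 - int t))" for k
      define z where "z k = (\<Sum>t<k. g (i + 1 + int t))" for k
      have sx: "spread l N ?C x" and sz: "spread l N ?B z"
        unfolding x_def z_def K_def using spread_of_gaps[of "\<lambda>t. g (i - 1 - int t)" l N]
          spread_of_gaps[of "\<lambda>t. g (i + 1 + int t)" l N] g1 by (auto simp: ac_simps)
      obtain a b where ab: "1 \<le> a" "1 \<le> b" "a + b = 3 * int l + 1 + (g i - int K)"
        and less: "load l N x a + load l N z b < 1"
        using ex_underloaded[OF l sx sz run_credit_nonneg run_credit_nonneg, of "g i - int K"]
          excess unpaid by auto
      have abg: "a + b = g i" using ab(3) by (simp add: K_def)
      \<comment> \<open>The underloaded vertex, \<open>a\<close> after \<open>p i\<close> and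
        \<open>b\<close> before \<open>p (i + 1)\<close>.\<close>
      define v where "v = (p i + a) mod int n"
      have vV: "v \<in> circ_verts n" using n0 by (simp add: v_def circ_verts_def)
      have behind: "(\<Sum>d\<in>D. decay l ((v - d) mod int n)) = load l N x a"
      proof -
        have "(\<Sum>d\<in>D. decay l ((v - d) mod int n))
            = (\<Sum>k<N. decay l ((v - p (i - int k) mod int n) mod int n))"
          using sum.reindex_bij_betw[OF bij_betw_lift_enum_down[OF DE, of i],
              of "\<lambda>d. decay l ((v - d) mod int n)"] by (simp add: N_def p_def)
        also have "\<dots> = load l N x a"
          unfolding load_def
        proof (rule sum.cong)
          fix k assume "k \<in> {..<N}"
          then have k: "k < N" by simp
          \<comment> \<open>Going backward from \<open>v\<close>, the farthest point of
            \<open>D\<close> is the far end of the gap, at distance \<open>n - b < n\<close>; hence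
            reduction modulo \<open>n\<close> changes nothing.\<close>
          have "p (i + 1) = p (i - int (N - 1)) + int n"
            using p_period[of "i - int (N - 1)"] N by (simp add: of_nat_diff)
          then have "a + x k < int n"
            using mono(1)[OF k, of i] ab(2) abg unfolding x_def down unfolding g_def by linarith
          moreover have "0 \<le> x k" using sx k by (simp add: spread_def)
          moreover have "(v - p (i - int k) mod int n) mod int n = (a + x k) mod int n"
          proof -
            have eq: "(p i + a) - p (i - int k) = a + x k" by (simp add: x_def down)
            show ?thesis unfolding eq[symmetric] v_def by (simp add: mod_simps)
          qed
          ultimately show "decay l ((v - p (i - int k) mod int n) mod int n) = decay l (a + x k)"
            using ab(1) by simp
        qed simp
        finally show ?thesis .
      qed
      have ahead: "(\<Sum>d\<in>D. decay l ((d - v) mod int n)) = load l N z b"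
      proof -
        have "(\<Sum>d\<in>D. decay l ((d - v) mod int n))
            = (\<Sum>k<N. decay l ((p (i + 1 + int k) mod int n - v) mod int n))"
          using sum.reindex_bij_betw[OF bij_betw_lift_enum_up[OF DE, of "i + 1"],
              of "\<lambda>d. decay l ((d - v) mod int n)"] by (simp add: N_def p_def)
        also have "\<dots> = load l N z b"
          unfolding load_def
        proof (rule sum.cong)
          fix k assume "k \<in> {..<N}"
          then have k: "k < N" by simp
          have "p (i + 1 + int (N - 1)) = p i + int n"
            using p_period[of i] N by (simp add: of_nat_diff)
          then have "b + z k < int n"
            using mono(2)[OF k, of "i + 1"] ab(1) abg unfolding z_def up unfolding g_def by linarith
          moreover have "0 \<le> z k" using sz k by (simp add: spread_def)
          moreover have "(p (i + 1 + int k) mod int n - v) mod int n = (b + z k) mod int n"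
          proof -
            have "p (i + 1 + int k) - (p i + a) = b + z k"
              using abg unfolding z_def up unfolding g_def by linarith
            then show ?thesis by (simp add: v_def mod_simps)
          qed
          ultimately show "decay l ((p (i + 1 + int k) mod int n - v) mod int n) = decay l (b + z k)"
            using ab(2) by simp
        qed simp
        finally show ?thesis .
      qed
      have "(\<Sum>d\<in>D. (1 / 2 :: real) powi (int (graph_dist (circ_edges n l) d v) - 1))
          \<le> (\<Sum>d\<in>D. decay l ((v - d) mod int n) + decay l ((d - v) mod int n))"
        using DV vV by (intro sum_mono dist_weight_le_decay[OF l n0]) auto
      also have "\<dots> < 1" using less by (simp add: sum.distrib behind ahead)
      finally show False using W_ge[OF vV] by simp
    qed
  qed (fact g_period)
  then have gK: "g (int i) = int K" if "i < N" for i using that by blast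
  have "int n = int K * int N" using total gK by (simp add: mult.commute)
  then have Nm: "N = m" using nK K by (simp flip: of_nat_mult)
  have p_eq: "p (int k) = p 0 + int (K * k)" if "k \<le> N" for k
  proof -
    have "(\<Sum>t<k. g (int t)) = (\<Sum>t<k. int K)" using that gK by (intro sum.cong) auto
    then show ?thesis using up[of 0 k] by (simp add: mult.commute)
  qed
  have "D = (\<lambda>k. p (int k) mod int n) ` {..<N}"
    using bij_betw_lift_enum_up[OF DE, of 0] by (simp add: bij_betw_def p_def N_def)
  also have "\<dots> = {(p 0 + int (K * t)) mod int n | t. t < m}"
    using p_eq Nm by (force simp: image_iff)
  also have "\<dots> = progression n K (p 0)" by (rule progression_eq[OF K m nK, symmetric])
  also have "\<dots> = progression n K (p 0 mod int n)"
    unfolding progression_def nK by (simp add: mod_mod_cancel)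
  finally have "D = progression n K (p 0 mod int n)" .
  moreover have "p 0 mod int n \<in> circ_verts n" using n0 by (simp add: circ_verts_def)
  ultimately show ?thesis unfolding K_def by blast
qed

section \<open>Structure of minimum dominating sets\<close>

theorem theorem2:
  fixes l m n :: nat and D :: "int set"
  assumes "l \<ge> 1" and "m \<ge> 2" and "n = (3 * l + 1) * m"
    and "min_porous_exp_dominating (circ_verts n) (circ_edges n l) D"
  shows "(\<forall>s::int. \<forall>i<m.
            card (circ_interval n (s + int ((3 * l + 1) * i))
                    (s + int ((3 * l + 1) * i) + 3 * int l) \<inter> D) = 1)
       \<and> (\<forall>I. interval_partition n m I \<and> (\<forall>k<m. card (I k) = 3 * l + 1) \<longrightarrow>
            f_star m D I = 1 \<and> Z_count m D I = 0)
       \<and> (\<forall>D'. min_porous_exp_dominating (circ_verts n) (circ_edges n l) D' \<longrightarrow>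
            (\<exists>\<phi>. graph_automorphism (circ_verts n) (circ_edges n l) \<phi> \<and> \<phi> ` D = D'))
       \<and> (\<exists>c\<in>circ_verts n. D = {(c + int ((3 * l + 1) * t)) mod int n | t. t < m})"
proof -
  define K where "K = 3 * l + 1"
  have K: "0 < K" and m: "0 < m" and n: "n = K * m" using assms by (auto simp: K_def)
  have n0: "0 < n" using K m n by simp
  have "K < n" using K n assms(2) by simp
  \<comment> \<open>Minimality enters only through comparison with the class of \<open>0\<close>,
    which bounds the cardinality by \<open>m\<close>.\<close>
  have ex_prog: "\<exists>c\<in>circ_verts n. E = progression n K c"
    if "min_porous_exp_dominating (circ_verts n) (circ_edges n l) E" for E
  proof -
    have "card E \<le> card (progression n K 0)"
      using that porous_exp_dominating_progression[OF assms(1-3)]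
      unfolding min_porous_exp_dominating_def K_def by blast
    then have "card E \<le> m" using card_progression_0_le(2)[OF K m n] by linarith
    then show ?thesis
      using progression_of_dominating[OF assms(1) m assms(3)] that
      unfolding min_porous_exp_dominating_def K_def by blast
  qed
  obtain c where c: "c \<in> circ_verts n" and D: "D = progression n K c"
    using ex_prog[OF assms(4)] by blast
  have one: "card (circ_interval n i j \<inter> D) = 1" if "(j - i) mod int n = int K - 1" for i j
    unfolding D by (rule card_circ_interval_inter_progression[OF K n m that])
  show ?thesis
  proof (intro conjI allI impI)
    fix s :: int and i
    show "card (circ_interval n (s + int ((3 * l + 1) * i))
                    (s + int ((3 * l + 1) * i) + 3 * int l) \<inter> D) = 1"
      using \<open>K < n\<close> by (intro one) (simp add: K_def)
  next
    fix I assume I: "interval_partition n m I \<and> (\<forall>k<m. card (I k) = 3 * l + 1)"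
    have f: "f_count D I k = 1" if k: "k < m" for k
    proof -
      \<comment> \<open>The endpoints are arbitrary integers, but the cardinality of the interval
        fixes \<open>(b - a) mod int n\<close>.\<close>
      obtain a b where ab: "I k = circ_interval n a b"
        using I k by (auto simp: interval_partition_def)
      then have "nat ((b - a) mod int n) + 1 = K"
        using I k card_circ_interval[OF n0, of a b] unfolding K_def by metis
      moreover have "0 \<le> (b - a) mod int n" using n0 by simp
      ultimately have "(b - a) mod int n = int K - 1" by linarith
      then show ?thesis using one ab by (simp add: f_count_def)
    qed
    have "f_count D I ` {..<m} = {1}" using f m by force
    then show "f_star m D I = 1" by (simp add: f_star_def)
    show "Z_count m D I = 0" using f by (auto simp: Z_count_def z_set_def)
  next
    fix D' assume "min_porous_exp_dominating (circ_verts n) (circ_edges n l) D'"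
    then obtain c' where "D' = progression n K c'" using ex_prog by blast
    then show "\<exists>\<phi>. graph_automorphism (circ_verts n) (circ_edges n l) \<phi> \<and> \<phi> ` D = D'"
      unfolding D using rotation_progression[OF K n m] by simp
  next
    show "\<exists>c\<in>circ_verts n. D = {(c + int ((3 * l + 1) * t)) mod int n | t. t < m}"
      using c D progression_eq[OF K m n, of c] by (auto simp: K_def)
  qed
qed

end
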